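(* The probabilistic weak call-by-value $\lambda$-calculus $\Lambda_\oplus^{\mathrm{weak}}=(\mathrm{m}\Lambda_\oplus,\Rightarrow)$ satisfies $\mathrm{nf}$-RD: for every multidistribution $\mathrm{m}$ of terms and every two $\Rightarrow$-sequences $\langle\mathrm{r}_n\rangle,\langle\mathrm{s}_n\rangle$ from $\mathrm{m}$, $\mathrm{nf}(\mathrm{r}_n)=\mathrm{nf}(\mathrm{s}_n)$ for all $n$.
   Context: Terms $M::=x\mid\lambda x.M\mid MM\mid M\oplus M$ (the set $\Lambda_\oplus$, up to $\alpha$-equivalence); values $V::=x\mid\lambda x.M$; $M[x:=V]$ is capture-avoiding substitution. The relation $\to\subseteq\Lambda_\oplus\times\mathcal D^{fin}(\Lambda_\oplus)$ (finitely supported probability distributions) is inductively defined by: $(\lambda x.M)V\to\{M[x:=V]^1\}$; $P\oplus Q\to\{P^{1/2}\}+\{Q^{1/2}\}$; if $N\to\{N_i^{p_i}\mid i\in I\}$ then $MN\to\{(MN_i)^{p_i}\mid i\in I\}$; if $M\to\{M_i^{p_i}\mid i\in I\}$ then $MN\to\{(M_iN)^{p_i}\mid i\in I\}$. A term is a normal form if it has no $\to$-reduction; $\mathrm{NF}$ is the set of normal forms. A multidistribution is a finite multiset $[p_iM_i\mid i\in I]$ with $p_i\in(0,1]$, $\sum p_i\le1$; $\mathrm{m}\Lambda_\oplus$ is their set, $[M]=[1M]$, $+$ is multiset union, $q\cdot[p_iM_i]=[(qp_i)M_i]$. $\Rightarrow$ is the least relation on multidistributions with: (L1) $[M]\Rightarrow[M]$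 for $M$ normal; (L2) $[M]\Rightarrow[p_kM_k\mid k\in K]$ if $M\to\{M_k^{p_k}\mid k\in K\}$; (L3) if $[M_i]\Rightarrow\mathrm{m}_i$ for all $i\in I$ then $[p_iM_i\mid i\in I]\Rightarrow\sum_ip_i\cdot\mathrm{m}_i$. For $\mathrm{m}=[p_iM_i]$, $\mathrm{nf}(\mathrm{m})$ is the subdistribution on $\mathrm{NF}$ with $\mathrm{nf}(\mathrm{m})(U)=\sum_{i:M_i=U}p_i$. A $\Rightarrow$-sequence from $\mathrm{m}$ is an infinite sequence $\mathrm{m}=\mathrm{m}_0\Rightarrow\mathrm{m}_1\Rightarrow\cdots$. *)

theory Defs
  imports "HOL-Probability.Probability" "HOL-Library.Multiset"
begin

(* Terms up to alpha-equivalence are represented with de Bruijn indices;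
   an index that exceeds the number of enclosing binders is a free variable. *)
datatype trm =
    Var nat
  | Lam trm
  | App trm trm
  | Choice trm trm

fun is_value :: "trm \<Rightarrow> bool" where
  "is_value (Var i) = True"
| "is_value (Lam M) = True"
| "is_value (App M N) = False"
| "is_value (Choice M N) = False"

primrec shift :: "trm \<Rightarrow> nat \<Rightarrow> trm" where
  "shift (Var i) k = (if i < k then Var i else Var (Suc i))"
| "shift (Lam M) k = Lam (shift M (Suc k))"
| "shift (App M N) k = App (shift M k) (shift N k)"
| "shift (Choice M N) k = Choice (shift M k) (shift N k)"

(* Substitution of V for index k that also removes the binder for k:
   the indices above k are decremented. *)
primrec subst :: "trm \<Rightarrow> trm \<Rightarrow> nat \<Rightarrow> trm" where
  "subst (Var i) V k = (if k < i then Var (i - 1) else if i = k then V else Var i)"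
| "subst (Lam M) V k = Lam (subst M (shift V 0) (Suc k))"
| "subst (App M N) V k = App (subst M V k) (subst N V k)"
| "subst (Choice M N) V k = Choice (subst M V k) (subst N V k)"

definition fair :: "'a \<Rightarrow> 'a \<Rightarrow> 'a pmf" where
  "fair P Q = map_pmf (\<lambda>b. if b then P else Q) (bernoulli_pmf (1/2))"

lemma pmf_fair:
  "pmf (fair P Q) U = (1/2) * indicator {P} U + (1/2) * indicator {Q} U"
proof -
  have "pmf (fair P Q) U =
      measure_pmf.prob (bernoulli_pmf (1/2)) ((\<lambda>b. if b then P else Q) -` {U})"
    by (simp add: fair_def pmf_map)
  also have "((\<lambda>b. if b then P else Q) -` {U}) =
      (if P = U then {True} else {}) \<union> (if Q = U then {False} else {})"
    by (auto split: if_splits)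
  also have "measure_pmf.prob (bernoulli_pmf (1/2)) \<dots> =
      (1/2) * indicator {P} U + (1/2) * indicator {Q} U"
    by (auto simp: measure_measure_pmf_finite)
  finally show ?thesis .
qed

(* The images of distributions below are taken along the injective maps
   App M and (\<lambda>M. App M N), so no two outcomes are identified. *)
inductive step :: "trm \<Rightarrow> trm pmf \<Rightarrow> bool" where
  beta: "is_value V \<Longrightarrow> step (App (Lam M) V) (return_pmf (subst M V 0))"
| choice: "step (Choice P Q) (fair P Q)"
| right: "step N \<mu> \<Longrightarrow> step (App M N) (map_pmf (App M) \<mu>)"
| left: "step M \<mu> \<Longrightarrow> step (App M N) (map_pmf (\<lambda>M'. App M' N) \<mu>)"

lemma step_finite_support: "step M \<mu> \<Longrightarrow> finite (set_pmf \<mu>)"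
  by (induction rule: step.induct) (auto simp: fair_def)

definition NF :: "trm set" where
  "NF = {M. \<not> (\<exists>\<mu>. step M \<mu>)}"

definition multidist :: "(real \<times> 'a) multiset \<Rightarrow> bool" where
  "multidist m \<longleftrightarrow>
     (\<forall>(p, M) \<in># m. 0 < p \<and> p \<le> 1) \<and> (\<Sum>(p, M) \<in># m. p) \<le> 1"

definition mscale :: "real \<Rightarrow> (real \<times> 'a) multiset \<Rightarrow> (real \<times> 'a) multiset" where
  "mscale q m = image_mset (\<lambda>(p, M). (q * p, M)) m"

(* Each element of the support of a finitely supported distribution
   occurs exactly once in the associated multidistribution. *)
definition mdist_of_pmf :: "'a pmf \<Rightarrow> (real \<times> 'a) multiset" where
  "mdist_of_pmf \<mu> = image_mset (\<lambda>M. (pmf \<mu> M, M)) (mset_set (set_pmf \<mu>))"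

(* Finite families are indexed by finite sets of natural numbers. *)
inductive mstep :: "(real \<times> trm) multiset \<Rightarrow> (real \<times> trm) multiset \<Rightarrow> bool"
    (infix "\<Rrightarrow>" 50) where
  L1: "M \<in> NF \<Longrightarrow> {#(1, M)#} \<Rrightarrow> {#(1, M)#}"
| L2: "step M \<mu> \<Longrightarrow> {#(1, M)#} \<Rrightarrow> mdist_of_pmf \<mu>"
| L3: "finite (I :: nat set) \<Longrightarrow>
       multidist (image_mset (\<lambda>i. (p i, M i)) (mset_set I)) \<Longrightarrow>
       (\<And>i. i \<in> I \<Longrightarrow> {#(1, M i)#} \<Rrightarrow> m i) \<Longrightarrow>
       image_mset (\<lambda>i. (p i, M i)) (mset_set I) \<Rrightarrow> (\<Sum>i\<in>I. mscale (p i) (m i))"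

lemma multidist_mdist_of_pmf:
  assumes "finite (set_pmf \<mu>)"
  shows "multidist (mdist_of_pmf \<mu>)"
proof -
  have "(\<Sum>M \<in> set_pmf \<mu>. pmf \<mu> M) = 1"
    using assms by (simp add: sum_pmf_eq_1)
  then show ?thesis
    using assms
    by (auto simp: multidist_def mdist_of_pmf_def pmf_positive pmf_le_1 image_mset.compositionality o_def
        sum_unfold_sum_mset)
qed

lemma mass_mscale: "(\<Sum>(q, N) \<in># mscale c k. q) = c * (\<Sum>(q, N) \<in># k. q)"
  unfolding mscale_def by (induction k) (auto simp: algebra_simps)

lemma multidist_sum_mscale:
  assumes "finite I" "multidist (image_mset (\<lambda>i. (p i, M i)) (mset_set I))"
    and m: "\<And>i. i \<in> I \<Longrightarrow> multidist (m i)"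
  shows "multidist (\<Sum>i\<in>I. mscale (p i) (m i))"
proof -
  have p: "0 < p i" "p i \<le> 1" if "i \<in> I" for i
    using assms that by (auto simp: multidist_def)
  have p1: "sum p I \<le> 1"
    using assms
    by (simp add: multidist_def image_mset.compositionality o_def sum_unfold_sum_mset)
  have mem: "\<exists>i\<in>I. x \<in># mscale (p i) (m i)" if "x \<in># (\<Sum>i\<in>I. mscale (p i) (m i))" for x
    using that \<open>finite I\<close> by (auto simp: set_mset_sum)
  have "0 < q \<and> q \<le> 1" if "(q, N) \<in># (\<Sum>i\<in>I. mscale (p i) (m i))" for q N
  proof -
    from mem[OF that] obtain i q' where i: "i \<in> I" "(q', N) \<in># m i" "q = p i * q'"
      by (auto simp: mscale_def)
    with m[of i] have "0 < q'" "q' \<le> 1" by (auto simp: multidist_def)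
    with p[of i] i show ?thesis by (auto intro: mult_le_one)
  qed
  moreover have "(\<Sum>(q, N) \<in># (\<Sum>i\<in>I. mscale (p i) (m i)). q) \<le> 1"
  proof -
    have "(\<Sum>(q, N) \<in># (\<Sum>i\<in>I. mscale (p i) (m i)). q) =
        (\<Sum>i\<in>I. \<Sum>(q, N) \<in># mscale (p i) (m i). q)"
      using \<open>finite I\<close> by (induction I rule: finite_induct) auto
    also have "\<dots> = (\<Sum>i\<in>I. p i * (\<Sum>(q, N) \<in># m i. q))"
      by (simp add: mass_mscale)
    also have "\<dots> \<le> (\<Sum>i\<in>I. p i * 1)"
      using p m by (intro sum_mono mult_left_mono) (auto simp: multidist_def less_imp_le)
    finally show ?thesis using p1 by simp
  qed
  ultimately show ?thesis unfolding multidist_def by blast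
qed

lemma mstep_multidist: "m \<Rrightarrow> m' \<Longrightarrow> multidist m \<and> multidist m'"
proof (induction rule: mstep.induct)
  case (L1 M)
  then show ?case by (simp add: multidist_def)
next
  case (L2 M \<mu>)
  then show ?case
    using multidist_mdist_of_pmf[OF step_finite_support] by (simp add: multidist_def)
next
  case (L3 I p M m)
  then show ?case using multidist_sum_mscale by blast
qed

(* The subdistribution on NF is extended by 0 to all terms. *)
definition nf :: "(real \<times> trm) multiset \<Rightarrow> trm \<Rightarrow> real" where
  "nf m U = (if U \<in> NF then \<Sum>(p, M) \<in># filter_mset (\<lambda>(p, M). M = U) m. p else 0)"

definition mseq_from :: "(real \<times> trm) multiset \<Rightarrow> (nat \<Rightarrow> (real \<times> trm) multiset) \<Rightarrow> bool" where
  "mseq_from m r \<longleftrightarrow> r 0 = m \<and> (\<forall>n. r n \<Rrightarrow> r (Suc n))"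

end

(* The probability of having reached a given normal form after n steps does not depend on the
   sequence: two different steps from the same term are closed by one further step on each side
   (a diamond), so by induction on n any first step yields the same n-step outcome. The outcome
   of M in n steps is the distribution on "trm option" obtained by following one fixed choice
   of steps, where None collects the terms that are not yet normal. Every mstep then preserves
   the total mass of each normal form while lowering n by one. *)
theory Submission imports Defs begin

lemma value_no_step: "is_value V \<Longrightarrow> \<not> step V \<mu>"
  by (cases V) (auto elim: step.cases)

text \<open>Every term in the support has to move; none may stay put. This keeps the two sides of
  the diamond at equal length.\<close>

definition pmf_step :: "trm pmf \<Rightarrow> trm pmf \<Rightarrow> bool" where
  "pmf_step \<mu> \<rho> \<longleftrightarrow> (\<exists>K. (\<forall>N\<in>set_pmf \<mu>. step N (K N)) \<and> \<rho> = bind_pmf \<mu> K)"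

lemma pmf_step_map:
  assumes "pmf_step \<mu> \<rho>" "inj f" "\<And>N \<nu>. step N \<nu> \<Longrightarrow> step (f N) (map_pmf f \<nu>)"
  shows "pmf_step (map_pmf f \<mu>) (map_pmf f \<rho>)"
proof -
  obtain K where K: "\<And>N. N \<in> set_pmf \<mu> \<Longrightarrow> step N (K N)" "\<rho> = bind_pmf \<mu> K"
    using assms(1) by (auto simp: pmf_step_def)
  show ?thesis
    \<comment> \<open>Injectivity of \<open>f\<close> lets the reduct of \<open>f N\<close> be
      chosen through the preimage \<open>N\<close>.\<close>
    unfolding pmf_step_def
    by (rule exI[where x = "\<lambda>X. map_pmf f (K (inv f X))"])
      (use K assms(2,3) in \<open>auto simp: bind_map_pmf map_bind_pmf\<close>)
qed

text \<open>The two steps act on disjoint subterms, so they are independent: performed in either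
  order they give the product of \<open>\<mu>\<close> and \<open>\<nu>\<close>.\<close>

lemma step_left_right_commute:
  assumes "step M \<mu>" "step N \<nu>"
  shows "\<exists>\<rho>. pmf_step (map_pmf (\<lambda>M'. App M' N) \<mu>) \<rho> \<and> pmf_step (map_pmf (App M) \<nu>) \<rho>"
proof (intro exI conjI)
  have invL: "inv (\<lambda>M'. App M' N) (App M' N) = M'" for M'
    by (rule inv_f_f[where f = "\<lambda>M'. App M' N"]) (simp add: inj_def)
  have invR: "inv (App M) (App M N') = N'" for N'
    by (simp add: inj_def inv_f_f)
  let ?\<rho> = "bind_pmf \<mu> (\<lambda>M'. map_pmf (App M') \<nu>)"
  show "pmf_step (map_pmf (\<lambda>M'. App M' N) \<mu>) ?\<rho>"
    unfolding pmf_step_def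
    by (rule exI[where x = "\<lambda>X. map_pmf (App (inv (\<lambda>M'. App M' N) X)) \<nu>"])
      (use assms in \<open>auto simp: bind_map_pmf invL intro: step.right\<close>)
  have "?\<rho> = bind_pmf \<nu> (\<lambda>N'. map_pmf (\<lambda>M'. App M' N') \<mu>)"
    unfolding map_pmf_def by (rule bind_commute_pmf)
  then show "pmf_step (map_pmf (App M) \<nu>) ?\<rho>"
    unfolding pmf_step_def
    by (intro exI[where x = "\<lambda>X. map_pmf (\<lambda>M'. App M' (inv (App M) X)) \<mu>"])
      (use assms in \<open>auto simp: bind_map_pmf invR intro: step.left\<close>)
qed

text \<open>A beta redex is built from two values, which do not reduce, so it overlaps with no other
  redex. Steps on the same side of an application close by induction, steps on opposite sides
  commute.\<close>

lemma step_diamond: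
  "step M \<mu> \<Longrightarrow> step M \<nu> \<Longrightarrow> \<mu> = \<nu> \<or> (\<exists>\<rho>. pmf_step \<mu> \<rho> \<and> pmf_step \<nu> \<rho>)"
proof (induction arbitrary: \<nu> rule: step.induct)
  case (beta V M)
  from beta(2) show ?case
    by cases (use beta value_no_step[of "Lam M"] value_no_step[of V] in auto)
next
  case (choice P Q)
  then show ?case by cases auto
next
  case (right N \<mu> M)
  from right.prems show ?case
  proof cases
    case beta
    with right.hyps value_no_step show ?thesis by blast
  next
    case (right \<nu>')
    then show ?thesis
      using right.IH[of \<nu>'] pmf_step_map[of _ _ "App M"] step.right by (fastforce simp: inj_def)
  next
    case (left \<nu>')
    then show ?thesis using step_left_right_commute[OF left(2) right.hyps] by blast
  qed
next
  case (left M \<mu> N)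
  from left.prems show ?case
  proof cases
    case beta
    with left.hyps value_no_step[of M] show ?thesis by auto
  next
    case (right \<nu>')
    then show ?thesis using step_left_right_commute[OF left.hyps right(2)] by blast
  next
    case (left \<nu>')
    then show ?thesis
      using left.IH[of \<nu>'] pmf_step_map[of _ _ "\<lambda>M'. App M' N"] step.left
      by (fastforce simp: inj_def)
  qed
qed

fun outcome :: "nat \<Rightarrow> trm \<Rightarrow> trm option pmf" where
  "outcome 0 M = return_pmf (if M \<in> NF then Some M else None)"
| "outcome (Suc n) M =
     (if M \<in> NF then return_pmf (Some M) else bind_pmf (SOME \<mu>. step M \<mu>) (outcome n))"

lemma outcome_NF: "M \<in> NF \<Longrightarrow> outcome n M = return_pmf (Some M)"
  by (cases n) auto

lemma outcome_step: "step M \<mu> \<Longrightarrow> outcome (Suc n) M = bind_pmf \<mu> (outcome n)"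
proof (induction n arbitrary: M \<mu> rule: less_induct)
  case (less n)
  define \<nu> where "\<nu> = (SOME \<nu>. step M \<nu>)"
  have \<nu>: "step M \<nu>" unfolding \<nu>_def using less.prems by (rule someI)
  have "M \<notin> NF" using less.prems by (auto simp: NF_def)
  then have M: "outcome (Suc n) M = bind_pmf \<nu> (outcome n)" by (simp add: \<nu>_def)
  \<comment> \<open>The right-hand side depends on \<open>\<kappa>\<close> only through
    \<open>\<rho>\<close>, so both sides of a diamond get the same value. For \<open>n = 0\<close>
    all mass sits on reducible terms, hence on \<open>None\<close>.\<close>
  have unfold: "bind_pmf \<kappa> (outcome n) =
      (case n of 0 \<Rightarrow> return_pmf None | Suc k \<Rightarrow> bind_pmf \<rho> (outcome k))"
    if closed: "pmf_step \<kappa> \<rho>" for \<kappa> \<rho>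
  proof -
    obtain K where K: "\<And>N. N \<in> set_pmf \<kappa> \<Longrightarrow> step N (K N)" "\<rho> = bind_pmf \<kappa> K"
      using closed by (auto simp: pmf_step_def)
    show ?thesis
    proof (cases n)
      case 0
      have "bind_pmf \<kappa> (outcome 0) = bind_pmf \<kappa> (\<lambda>_. return_pmf None)"
        using K(1) by (intro bind_pmf_cong) (auto simp: NF_def)
      with 0 show ?thesis by simp
    next
      case (Suc k)
      have "bind_pmf \<kappa> (outcome (Suc k)) = bind_pmf \<kappa> (\<lambda>N. bind_pmf (K N) (outcome k))"
        using K(1) Suc less.IH[of k] by (intro bind_pmf_cong) auto
      with K(2) Suc show ?thesis by (simp add: bind_assoc_pmf)
    qed
  qed
  show ?case
    using step_diamond[OF \<nu> less.prems] M unfold by auto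
qed

definition reach_mass :: "nat \<Rightarrow> (real \<times> trm) multiset \<Rightarrow> trm \<Rightarrow> real" where
  "reach_mass n m U = (\<Sum>(p, M) \<in># m. p * pmf (outcome n M) (Some U))"

lemma reach_mass_sum: "reach_mass n (\<Sum>i\<in>I. f i) U = (\<Sum>i\<in>I. reach_mass n (f i) U)"
  by (induction I rule: infinite_finite_induct) (auto simp: reach_mass_def)

lemma reach_mass_mscale: "reach_mass n (mscale q m) U = q * reach_mass n m U"
  unfolding reach_mass_def mscale_def by (induction m) (auto simp: algebra_simps)

lemma reach_mass_mdist_of_pmf:
  assumes "finite (set_pmf \<mu>)"
  shows "reach_mass n (mdist_of_pmf \<mu>) U = pmf (bind_pmf \<mu> (outcome n)) (Some U)"
proof -
  have "pmf (bind_pmf \<mu> (outcome n)) (Some U) =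
      (\<Sum>M\<in>set_pmf \<mu>. pmf \<mu> M * pmf (outcome n M) (Some U))"
    unfolding pmf_bind using assms
    by (subst integral_measure_pmf[where A = "set_pmf \<mu>"]) (auto simp: set_pmf_iff)
  then show ?thesis
    by (simp add: reach_mass_def mdist_of_pmf_def image_mset.compositionality o_def
        sum_unfold_sum_mset)
qed

text \<open>A normal form has the same outcome for every \<open>n\<close>, a reduction is covered by
  \<open>outcome_step\<close> whichever redex is contracted, and L3 follows by linearity in the
  weights.\<close>

lemma reach_mass_mstep: "m \<Rrightarrow> m' \<Longrightarrow> reach_mass (Suc n) m U = reach_mass n m' U"
proof (induction rule: mstep.induct)
  case (L1 M)
  then show ?case by (simp add: reach_mass_def outcome_NF del: outcome.simps)
next
  case (L2 M \<mu>)
  have "reach_mass (Suc n) {#(1, M)#} U = pmf (outcome (Suc n) M) (Some U)"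
    by (simp add: reach_mass_def del: outcome.simps)
  with L2 show ?case
    by (simp add: outcome_step reach_mass_mdist_of_pmf step_finite_support del: outcome.simps)
next
  case (L3 I p M m)
  have "reach_mass (Suc n) (image_mset (\<lambda>i. (p i, M i)) (mset_set I)) U =
      (\<Sum>i\<in>I. p i * reach_mass (Suc n) {#(1, M i)#} U)"
    by (simp add: reach_mass_def image_mset.compositionality o_def sum_unfold_sum_mset
        del: outcome.simps)
  also have "\<dots> = (\<Sum>i\<in>I. p i * reach_mass n (m i) U)"
    using L3.IH by simp
  finally show ?case by (simp add: reach_mass_sum reach_mass_mscale)
qed

text \<open>With no steps left, \<open>outcome\<close> is a point mass: on \<open>Some M\<close> for
  normal \<open>M\<close>, otherwise on \<open>None\<close>.\<close>

lemma nf_eq_reach_mass: "nf m U = reach_mass 0 m U"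
proof (cases "U \<in> NF")
  case True
  then show ?thesis
    unfolding nf_def reach_mass_def by (induction m) (auto simp: indicator_def)
next
  case False
  then show ?thesis
    unfolding nf_def reach_mass_def by (induction m) (auto simp: indicator_def)
qed

lemma nf_mseq_from:
  assumes "mseq_from m r"
  shows "nf (r n) U = reach_mass n m U"
proof -
  \<comment> \<open>Each step of the sequence uses up one unit of \<open>k\<close>, so the induction
    needs its hypothesis at \<open>Suc k\<close>.\<close>
  have "reach_mass k (r n) U = reach_mass (k + n) m U" for k
  proof (induction n arbitrary: k)
    case 0
    with assms show ?case by (simp add: mseq_from_def)
  next
    case (Suc n)
    have "r n \<Rrightarrow> r (Suc n)" using assms by (simp add: mseq_from_def)
    from reach_mass_mstep[OF this, of k U] Suc.IH[of "Suc k"] show ?case by simp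
  qed
  from this[of 0] show ?thesis by (simp add: nf_eq_reach_mass)
qed

theorem mainTheorem16:
  fixes m :: "(real \<times> trm) multiset"
    and r s :: "nat \<Rightarrow> (real \<times> trm) multiset"
  assumes "multidist m"
    and "mseq_from m r"
    and "mseq_from m s"
  shows "\<forall>n. nf (r n) = nf (s n)"
  \<comment> \<open>Both sides equal \<open>reach_mass n m\<close>, which mentions only the common
    start.\<close>
  using nf_mseq_from[OF assms(2)] nf_mseq_from[OF assms(3)] by (simp add: fun_eq_iff)

end
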